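(* Let $K : V \to V$ be a linear, self-adjoint, positive definite operator, $C = K^{-1}$, and let $D : H \to V$ be the grid operator with adjoint $D^* : V \to H$ defined in the context. Put $R = D D^* : V \to V$, and let \[ R = R_1 + R_2, \qquad R_1^* = R_2, \] be a triangular decomposition of $R$, i.e. with respect to the four-component decomposition $V = H_1^+ \oplus H_1^- \oplus H_2^+ \oplus H_2^-$ one of the operators $R_1, R_2 : V \to V$ is block lower triangular and the other is block upper triangular. Let $u^0 \in H$, let $N \ge 1$ be an integer, $\tau > 0$, and let $\varphi^0, \dots, \varphi^{N-1} \in H$. Consider the difference scheme with weight $\sigma \in \mathbb{R}$ for $\mathbf{g}^0, \dots, \mathbf{g}^N \in V$: \[ (C + \sigma \tau R_1)\, C^{-1} (C + \sigma \tau R_2) \frac{\mathbf{g}^{n+1} - \mathbf{g}^{n}}{\tau} + R \mathbf{g}^{n} = D \varphi^n, \quad n = 0,1,\dots,N-1, \qquad \mathbf{g}^0 = K D u^0 . \] If $\sigma \ge 0.5$, then the scheme is unconditionally stable: for every $\tau > 0$ (with no restriction relating $\tau$ to the grid steps), the operator \[ B = (C + \sigma \tau R_1)\, C^{-1} (C + \sigma \tau R_2) - \frac{\tau}{2} R \] is self-adjoint and positive definite (so that $\|\cdot\|_B$ and $\|\cdot\|_{B^{-1}}$ are norms), and the solution of the scheme satisfies \[ \|\mathbf{g}^{n+1}\|_B \le \|\mathbf{g}^{n}\|_B + \tau \| D \varphi^n \|_{B^{-1}}, \quad n = 0,1,\dots,N-1 . \]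
   Context: Grid. Let $l_1, l_2 > 0$, let $N_1, N_2$ be positive integers and $h_\alpha = l_\alpha / N_\alpha$, $\alpha = 1,2$. Let $\overline{\omega} = \{ (i_1 h_1, i_2 h_2) : i_\alpha = 0,1,\dots,N_\alpha,\ \alpha = 1,2 \}$, let $\omega$ be its set of interior nodes ($1 \le i_\alpha \le N_\alpha - 1$), and $\partial\omega = \overline{\omega} \setminus \omega$. $H$ is the finite-dimensional real Hilbert space of grid functions $y$ on $\overline{\omega}$ with $y = 0$ on $\partial \omega$, with scalar product $(y,w) = \sum_{\bm{x} \in \omega} y(\bm{x}) w(\bm{x}) h_1 h_2$. Define the subgrids of points $(i_1 h_1, i_2 h_2)$: $\omega_1^+$: $0 \le i_1 \le N_1 - 1$, $1 \le i_2 \le N_2 - 1$; $\omega_1^-$: $1 \le i_1 \le N_1$, $1 \le i_2 \le N_2 - 1$; $\omega_2^+$: $1 \le i_1 \le N_1 - 1$, $0 \le i_2 \le N_2 - 1$; $\omega_2^-$: $1 \le i_1 \le N_1 - 1$, $1 \le i_2 \le N_2$. $H_\alpha^\pm$ is the space of real functions on $\omega_\alpha^\pm$ with scalar product $(y,w)_\alpha^\pm = \sum_{\bm{x} \in \omega_\alpha^\pm} y(\bm{x}) w(\bm{x}) h_1 h_2$. The space of grid vector functions is $V = H_1^+ \oplus H_1^- \oplus H_2^+ \oplus H_2^-$, with elements $\mathbf{q} = (q_1^+, q_1^-, q_2^+, q_2^-)^T$ and scalar product $(\mathbf{q}, \mathbf{g}) = \sum_{\alpha=1}^{2} \bigl(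 (q_\alpha^+, g_\alpha^+)_\alpha^+ + (q_\alpha^-, g_\alpha^-)_\alpha^- \bigr)$. Operators. With $e_\alpha$ the unit coordinate vector in direction $\alpha$, define $D_\alpha^\pm : H \to H_\alpha^\pm$ by $(D_\alpha^+ y)(\bm{x}) = - \dfrac{y(\bm{x} + h_\alpha e_\alpha) - y(\bm{x})}{h_\alpha}$ for $\bm{x} \in \omega_\alpha^+$, and $(D_\alpha^- y)(\bm{x}) = - \dfrac{y(\bm{x}) - y(\bm{x} - h_\alpha e_\alpha)}{h_\alpha}$ for $\bm{x} \in \omega_\alpha^-$. Set $D = (D_1^+, D_1^-, D_2^+, D_2^-)^T : H \to V$; $D^* = ((D_1^+)^*, (D_1^-)^*, (D_2^+)^*, (D_2^-)^* ) : V \to H$ is its adjoint. Norms. For a self-adjoint positive definite operator $S$ on $V$, $\|\mathbf{q}\|_S = (S \mathbf{q}, \mathbf{q})^{1/2}$. *)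

theory Defs
  imports "HOL-Analysis.Analysis" "HOL-Library.Function_Algebras"
begin

text \<open>Functions form a real vector space under the pointwise operations, so that operators
  can be added and scaled like vectors.\<close>

instantiation "fun" :: (type, scaleR) scaleR
begin
definition scaleR_fun_def: "c *\<^sub>R f = (\<lambda>x. c *\<^sub>R f x)"
instance ..
end

instance "fun" :: (type, real_vector) real_vector
  by standard (auto simp: fun_eq_iff scaleR_fun_def plus_fun_def scaleR_add_right scaleR_add_left)


text \<open>Operators between subspaces are total functions that matter only on the domain \<open>X\<close>.
  The inverse of an operator \<open>A\<close> on \<open>X\<close> is \<open>inv_into X A\<close>.\<close>

definition linear_on :: "'a::real_vector set \<Rightarrow> 'b::real_vector set \<Rightarrow> ('a \<Rightarrow> 'b) \<Rightarrow> bool" where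
  "linear_on X Y A \<longleftrightarrow>
     (\<forall>x\<in>X. A x \<in> Y) \<and>
     (\<forall>x\<in>X. \<forall>y\<in>X. A (x + y) = A x + A y) \<and>
     (\<forall>c. \<forall>x\<in>X. A (c *\<^sub>R x) = c *\<^sub>R A x)"

text \<open>The analogue of the library's \<open>adjoint\<close>, relative to subspaces \<open>X\<close>, \<open>Y\<close> with scalar
  products \<open>ipX\<close>, \<open>ipY\<close>. It is determined on \<open>Y\<close> only.\<close>

definition adjoint_on ::
  "'a set \<Rightarrow> ('a \<Rightarrow> 'a \<Rightarrow> real) \<Rightarrow> 'b set \<Rightarrow> ('b \<Rightarrow> 'b \<Rightarrow> real) \<Rightarrow> ('a \<Rightarrow> 'b) \<Rightarrow> 'b \<Rightarrow> 'a" where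
  "adjoint_on X ipX Y ipY A =
     (SOME A'. (\<forall>y\<in>Y. A' y \<in> X) \<and> (\<forall>x\<in>X. \<forall>y\<in>Y. ipY (A x) y = ipX x (A' y)))"

definition self_adjoint_on :: "'a set \<Rightarrow> ('a \<Rightarrow> 'a \<Rightarrow> real) \<Rightarrow> ('a \<Rightarrow> 'a) \<Rightarrow> bool" where
  "self_adjoint_on X ip A \<longleftrightarrow> (\<forall>x\<in>X. \<forall>y\<in>X. ip (A x) y = ip x (A y))"

definition pos_def_on :: "'a::zero set \<Rightarrow> ('a \<Rightarrow> 'a \<Rightarrow> real) \<Rightarrow> ('a \<Rightarrow> 'a) \<Rightarrow> bool" where
  "pos_def_on X ip A \<longleftrightarrow> (\<forall>x\<in>X. x \<noteq> 0 \<longrightarrow> ip (A x) x > 0)"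

definition op_norm :: "('a \<Rightarrow> 'a \<Rightarrow> real) \<Rightarrow> ('a \<Rightarrow> 'a) \<Rightarrow> 'a \<Rightarrow> real" where
  "op_norm ip S q = sqrt (ip (S q) q)"

definition is_norm_on :: "'a::real_vector set \<Rightarrow> ('a \<Rightarrow> real) \<Rightarrow> bool" where
  "is_norm_on X \<nu> \<longleftrightarrow>
     (\<forall>x\<in>X. \<nu> x \<ge> 0) \<and>
     (\<forall>x\<in>X. \<nu> x = 0 \<longleftrightarrow> x = 0) \<and>
     (\<forall>c. \<forall>x\<in>X. \<nu> (c *\<^sub>R x) = \<bar>c\<bar> * \<nu> x) \<and>
     (\<forall>x\<in>X. \<forall>y\<in>X. \<nu> (x + y) \<le> \<nu> x + \<nu> y)"


text \<open>The pair \<open>(i\<^sub>1, i\<^sub>2)\<close> stands for the mesh point \<open>(i\<^sub>1 h\<^sub>1, i\<^sub>2 h\<^sub>2)\<close>. A real function on a set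
  of nodes is represented by its extension by zero to all index pairs; for \<open>H\<close> this also encodes
  the zero boundary values.\<close>

type_synonym node = "nat \<times> nat"
type_synonym grid_fun = "node \<Rightarrow> real"

definition funs_on :: "node set \<Rightarrow> grid_fun set" where
  "funs_on S = {y. \<forall>x. x \<notin> S \<longrightarrow> y x = 0}"

definition ip_on :: "real \<Rightarrow> real \<Rightarrow> node set \<Rightarrow> grid_fun \<Rightarrow> grid_fun \<Rightarrow> real" where
  "ip_on h1 h2 S y w = (\<Sum>x\<in>S. y x * w x * h1 * h2)"

definition interior_nodes :: "nat \<Rightarrow> nat \<Rightarrow> node set" where
  "interior_nodes N1 N2 = {1..N1 - 1} \<times> {1..N2 - 1}"

definition H_space :: "nat \<Rightarrow> nat \<Rightarrow> grid_fun set" where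
  "H_space N1 N2 = funs_on (interior_nodes N1 N2)"

definition ip_H :: "nat \<Rightarrow> nat \<Rightarrow> real \<Rightarrow> real \<Rightarrow> grid_fun \<Rightarrow> grid_fun \<Rightarrow> real" where
  "ip_H N1 N2 h1 h2 = ip_on h1 h2 (interior_nodes N1 N2)"


text \<open>The components of a grid vector function, in the order
  \<open>q\<^sub>1\<^sup>+, q\<^sub>1\<^sup>-, q\<^sub>2\<^sup>+, q\<^sub>2\<^sup>-\<close> given by \<open>comp_index\<close>.\<close>

datatype comp = Plus1 | Minus1 | Plus2 | Minus2

primrec comp_index :: "comp \<Rightarrow> nat" where
  "comp_index Plus1 = 1"
| "comp_index Minus1 = 2"
| "comp_index Plus2 = 3"
| "comp_index Minus2 = 4"

type_synonym grid_vec = "comp \<Rightarrow> grid_fun"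

primrec subgrid :: "nat \<Rightarrow> nat \<Rightarrow> comp \<Rightarrow> node set" where
  "subgrid N1 N2 Plus1 = {0..N1 - 1} \<times> {1..N2 - 1}"
| "subgrid N1 N2 Minus1 = {1..N1} \<times> {1..N2 - 1}"
| "subgrid N1 N2 Plus2 = {1..N1 - 1} \<times> {0..N2 - 1}"
| "subgrid N1 N2 Minus2 = {1..N1 - 1} \<times> {1..N2}"

definition V_space :: "nat \<Rightarrow> nat \<Rightarrow> grid_vec set" where
  "V_space N1 N2 = {q. \<forall>k. q k \<in> funs_on (subgrid N1 N2 k)}"

definition ip_V :: "nat \<Rightarrow> nat \<Rightarrow> real \<Rightarrow> real \<Rightarrow> grid_vec \<Rightarrow> grid_vec \<Rightarrow> real" where
  "ip_V N1 N2 h1 h2 q g =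
     (\<Sum>k\<in>{Plus1, Minus1, Plus2, Minus2}. ip_on h1 h2 (subgrid N1 N2 k) (q k) (g k))"

primrec diff_quot :: "real \<Rightarrow> real \<Rightarrow> comp \<Rightarrow> grid_fun \<Rightarrow> node \<Rightarrow> real" where
  "diff_quot h1 h2 Plus1 y x = (y (fst x + 1, snd x) - y x) / h1"
| "diff_quot h1 h2 Minus1 y x = (y x - y (fst x - 1, snd x)) / h1"
| "diff_quot h1 h2 Plus2 y x = (y (fst x, snd x + 1) - y x) / h2"
| "diff_quot h1 h2 Minus2 y x = (y x - y (fst x, snd x - 1)) / h2"

definition grid_grad :: "nat \<Rightarrow> nat \<Rightarrow> real \<Rightarrow> real \<Rightarrow> grid_fun \<Rightarrow> grid_vec" where
  "grid_grad N1 N2 h1 h2 y =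
     (\<lambda>k x. if x \<in> subgrid N1 N2 k then - diff_quot h1 h2 k y x else 0)"


text \<open>\<open>block A j k\<close> is the \<open>(j, k)\<close> entry of \<open>A\<close> as a 4-by-4 operator matrix, mapping
  component \<open>k\<close> to component \<open>j\<close>.\<close>

definition block :: "(grid_vec \<Rightarrow> grid_vec) \<Rightarrow> comp \<Rightarrow> comp \<Rightarrow> grid_fun \<Rightarrow> grid_fun" where
  "block A j k y = A ((0::grid_vec)(k := y)) j"

definition block_lower_triangular :: "nat \<Rightarrow> nat \<Rightarrow> (grid_vec \<Rightarrow> grid_vec) \<Rightarrow> bool" where
  "block_lower_triangular N1 N2 A \<longleftrightarrow>
     (\<forall>j k. comp_index j < comp_index k \<longrightarrow>
        (\<forall>y \<in> funs_on (subgrid N1 N2 k). block A j k y = 0))"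

definition block_upper_triangular :: "nat \<Rightarrow> nat \<Rightarrow> (grid_vec \<Rightarrow> grid_vec) \<Rightarrow> bool" where
  "block_upper_triangular N1 N2 A \<longleftrightarrow>
     (\<forall>j k. comp_index k < comp_index j \<longrightarrow>
        (\<forall>y \<in> funs_on (subgrid N1 N2 k). block A j k y = 0))"

end

theory Submission
  imports Defs
begin

text \<open>Write \<open>s = \<sigma> \<tau>\<close>. Since \<open>C\<^sup>-\<^sup>1 = K\<close>, expanding the product gives
  \<open>B = C + (s - \<tau>/2) R + s\<^sup>2 R\<^sub>1 K R\<^sub>2\<close>, and \<open>R\<^sub>1\<^sup>* = R\<^sub>2\<close> turns the quadratic form of the last
  term into \<open>(K R\<^sub>2 q, R\<^sub>2 q) \<ge> 0\<close>. As \<open>R = D D\<^sup>* \<ge> 0\<close> and \<open>s \<ge> \<tau>/2\<close>, \<open>B\<close> is self-adjoint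
  and positive definite. The scheme reads
  \<open>B (g\<^sup>n\<^sup>+\<^sup>1 - g\<^sup>n) / \<tau> + R (g\<^sup>n\<^sup>+\<^sup>1 + g\<^sup>n) / 2 = D \<phi>\<^sup>n\<close>; pairing it with \<open>g\<^sup>n\<^sup>+\<^sup>1 + g\<^sup>n\<close> and applying the
  Cauchy-Schwarz inequality to \<open>(B\<^sup>-\<^sup>1 D \<phi>\<^sup>n, g\<^sup>n\<^sup>+\<^sup>1 + g\<^sup>n)\<close> in the scalar product of \<open>B\<close> yields the
  estimate.\<close>

section \<open>Linear operators on subspaces\<close>

lemma sum_fun_apply: "(\<Sum>i\<in>I. f i) x = (\<Sum>i\<in>I. f i x)"
  for f :: "'i \<Rightarrow> 'a \<Rightarrow> 'b::comm_monoid_add"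
  by (induction I rule: infinite_finite_induct) auto

lemma linear_on_0:
  assumes "linear_on X Y A" "subspace X"
  shows "A 0 = 0"
proof -
  have "A (0 *\<^sub>R 0) = 0 *\<^sub>R A 0"
    using assms subspace_0 unfolding linear_on_def by blast
  then show ?thesis by simp
qed

lemma linear_on_sum:
  assumes A: "linear_on X Y A" and X: "subspace X" and "finite I" "\<And>i. i \<in> I \<Longrightarrow> v i \<in> X"
  shows "A (\<Sum>i\<in>I. c i *\<^sub>R v i) = (\<Sum>i\<in>I. c i *\<^sub>R A (v i))"
  using assms(3,4)
proof (induction I rule: finite_induct)
  case empty
  show ?case using linear_on_0[OF A X] by simp
next
  case (insert i I)
  have "(\<Sum>i\<in>I. c i *\<^sub>R v i) \<in> X"
    using insert.prems by (intro subspace_sum[OF X]) (auto intro: subspace_scale[OF X])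
  moreover have "c i *\<^sub>R v i \<in> X"
    using insert.prems by (intro subspace_scale[OF X]) auto
  ultimately show ?case using insert A by (auto simp: linear_on_def)
qed

section \<open>Finite-dimensional spaces given by a Parseval frame\<close>

text \<open>The expansion makes \<open>e\<close> a Parseval frame. It forces \<open>X\<close> to be finite-dimensional and \<open>ip\<close> to
  be positive definite on \<open>X\<close>; on the ambient type \<open>ip\<close> may be degenerate.\<close>

locale finite_frame =
  fixes X :: "'a::real_vector set" and ip :: "'a \<Rightarrow> 'a \<Rightarrow> real"
    and I :: "'i set" and e :: "'i \<Rightarrow> 'a"
  assumes subspace: "subspace X"
    and commute: "ip x y = ip y x"
    and add_left: "ip (x + y) z = ip x z + ip y z"
    and scale_left: "ip (c *\<^sub>R x) z = c * ip x z"
    and finite_index: "finite I"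
    and frame_mem: "i \<in> I \<Longrightarrow> e i \<in> X"
    and expansion: "x \<in> X \<Longrightarrow> x = (\<Sum>i\<in>I. ip x (e i) *\<^sub>R e i)"
begin

lemma add_right: "ip z (x + y) = ip z x + ip z y"
  using add_left commute by metis

lemma scale_right: "ip z (c *\<^sub>R x) = c * ip z x"
  using scale_left commute by metis

lemma zero_left [simp]: "ip 0 x = 0"
  using scale_left[of 0 0 x] by simp

lemma zero_right [simp]: "ip x 0 = 0"
  using scale_right[of x 0 0] by simp

lemma sum_right: "ip z (\<Sum>j\<in>J. f j) = (\<Sum>j\<in>J. ip z (f j))"
  by (induction J rule: infinite_finite_induct) (auto simp: add_right)

text \<open>Pairing \<open>x\<close> with its own expansion gives the identity. It supplies the
  nonnegativity of \<open>ip\<close> on \<open>X\<close>, which the locale does not assume.\<close>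

lemma parseval:
  assumes "x \<in> X"
  shows "ip x x = (\<Sum>i\<in>I. (ip x (e i))\<^sup>2)"
proof -
  have "ip x x = ip x (\<Sum>i\<in>I. ip x (e i) *\<^sub>R e i)"
    using expansion[OF assms] by simp
  then show ?thesis by (simp add: sum_right scale_right power2_eq_square)
qed

lemma nonneg: "x \<in> X \<Longrightarrow> ip x x \<ge> 0"
  by (simp add: parseval sum_nonneg)

text \<open>Presents \<open>X\<close> as the span of a finite set, so that a finite basis can be
  extracted and counting arguments apply.\<close>

lemma span_frame: "span (e ` I) = X"
proof
  show "span (e ` I) \<subseteq> X" using frame_mem subspace by (intro span_minimal) auto
  show "X \<subseteq> span (e ` I)"
  proof
    fix x assume "x \<in> X"
    have "(\<Sum>i\<in>I. ip x (e i) *\<^sub>R e i) \<in> span (e ` I)"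
      by (intro span_sum span_scale span_base imageI)
    then show "x \<in> span (e ` I)" using expansion[OF \<open>x \<in> X\<close>] by simp
  qed
qed

section \<open>Positive definite operators and their inverses\<close>

lemma pos_def_onD: "pos_def_on X ip A \<Longrightarrow> x \<in> X \<Longrightarrow> x \<noteq> 0 \<Longrightarrow> ip (A x) x > 0"
  by (simp add: pos_def_on_def)

lemma pos_def_on_nonneg: "pos_def_on X ip A \<Longrightarrow> x \<in> X \<Longrightarrow> ip (A x) x \<ge> 0"
  by (cases "x = 0") (auto simp: pos_def_on_def less_imp_le)

text \<open>A basis \<open>S\<close> of \<open>X\<close> taken from the frame has an independent
  image with equally many elements. A vector of \<open>X\<close> outside the span of that image
  would produce more independent vectors than \<open>span S\<close> can hold.\<close>

lemma linear_on_inj_imp_surj: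
  assumes A: "linear_on X X A" and inj: "inj_on A X"
  shows "A ` X = X"
proof
  show "A ` X \<subseteq> X" using A by (auto simp: linear_on_def)
  obtain S where S: "S \<subseteq> e ` I" "independent S" "e ` I \<subseteq> span S"
    using maximal_independent_subset[of "e ` I"] by blast
  have fin: "finite S" using S finite_index finite_surj by blast
  have span_S: "span S = X"
    using S span_frame by (metis span_mono span_span subset_antisym)
  have SX: "S \<subseteq> X" using span_S span_superset by blast
  have card: "card (A ` S) = card S"
    using inj SX by (metis card_image inj_on_subset)
  \<comment> \<open>A linear relation among the images is \<open>A ?x = 0\<close>. Injectivity gives
    \<open>?x = 0\<close>, and independence of \<open>S\<close> makes the coefficients
    vanish.\<close>
  have "u w = 0" if u: "(\<Sum>v\<in>A ` S. u v *\<^sub>R v) = 0" and w: "w \<in> A ` S" for u w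
  proof -
    let ?x = "\<Sum>v\<in>S. u (A v) *\<^sub>R v"
    have "(\<Sum>v\<in>A ` S. u v *\<^sub>R v) = (\<Sum>v\<in>S. u (A v) *\<^sub>R A v)"
      using inj SX by (subst sum.reindex) (auto intro: inj_on_subset)
    also have "\<dots> = A ?x"
    proof (rule sym)
      show "A ?x = (\<Sum>v\<in>S. u (A v) *\<^sub>R A v)"
        by (rule linear_on_sum[OF A subspace fin]) (use SX in blast)
    qed
    finally have "A ?x = A 0" using u linear_on_0[OF A subspace] by simp
    moreover have "?x \<in> X"
      using SX by (intro subspace_sum[OF subspace]) (auto intro: subspace_scale[OF subspace])
    ultimately have "?x = 0" using inj subspace_0[OF subspace] by (auto dest: inj_onD)
    then show "u w = 0"
      using S(2) w fin by (auto simp: dependent_finite)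
  qed
  then have indep: "independent (A ` S)" using fin by (auto simp: dependent_finite)
  show "X \<subseteq> A ` X"
  proof
    fix x assume x: "x \<in> X"
    have sub: "span (A ` S) \<subseteq> A ` X"
    proof (rule span_minimal)
      show "A ` S \<subseteq> A ` X" using SX by blast
      show "Real_Vector_Spaces.subspace (A ` X)"
      proof (rule subspaceI)
        show "0 \<in> A ` X"
          using linear_on_0[OF A subspace] subspace_0[OF subspace] by force
        show "a + b \<in> A ` X" if ab: "a \<in> A ` X" "b \<in> A ` X" for a b
        proof -
          obtain x y where "x \<in> X" "y \<in> X" "a = A x" "b = A y" using ab by blast
          then have "a + b = A (x + y)" "x + y \<in> X"
            using A subspace_add[OF subspace] by (auto simp: linear_on_def)
          then show ?thesis by blast
        qed
        show "c *\<^sub>R a \<in> A ` X" if a: "a \<in> A ` X" for c a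
        proof -
          obtain x where "x \<in> X" "a = A x" using a by blast
          then have "c *\<^sub>R a = A (c *\<^sub>R x)" "c *\<^sub>R x \<in> X"
            using A subspace_scale[OF subspace] by (auto simp: linear_on_def)
          then show ?thesis by blast
        qed
      qed
    qed
    have AS: "A ` S \<subseteq> span S"
      using A SX span_S by (auto simp: linear_on_def)
    have "x \<in> span (A ` S)"
    proof (rule ccontr)
      assume nx: "x \<notin> span (A ` S)"
      then have "independent (insert x (A ` S))" using indep by (simp add: independent_insertI)
      moreover have "insert x (A ` S) \<subseteq> span S" using x AS span_S by simp
      ultimately have "card (insert x (A ` S)) \<le> card S"
        using independent_span_bound[OF fin] by blast
      moreover have "x \<notin> A ` S"
        using nx by (rule contrapos_nn) (rule span_base)
      then have "card (insert x (A ` S)) = Suc (card (A ` S))"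
        by (rule card_insert_disjoint[OF finite_imageI[OF fin]])
      ultimately show False using card by linarith
    qed
    then show "x \<in> A ` X" using sub by blast
  qed
qed

text \<open>A vector in the kernel of \<open>A\<close> has zero quadratic form, so it is zero;
  finite dimension then gives surjectivity.\<close>

lemma bij_betw_if_pos_def:
  assumes A: "linear_on X X A" and pos: "pos_def_on X ip A"
  shows "bij_betw A X X"
proof -
  have "inj_on A X"
  proof (rule inj_onI, rule ccontr)
    fix x y assume xy: "x \<in> X" "y \<in> X" "A x = A y" "x \<noteq> y"
    have d: "x - y \<in> X" using xy subspace_diff[OF subspace] by blast
    have "A x = A (x - y) + A y"
      using A xy d unfolding linear_on_def by (metis diff_add_cancel)
    then have "A (x - y) = 0" using xy by simp
    then show False using pos_def_onD[OF pos d] xy by simp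
  qed
  then show ?thesis using linear_on_inj_imp_surj[OF A] by (simp add: bij_betw_def)
qed

text \<open>With \<open>x = A y\<close> the form of the inverse at \<open>x\<close> is
  \<open>ip y (A y)\<close>, so symmetry and positivity carry over. It is needed twice: for
  \<open>C\<close>, the inverse of \<open>K\<close>, and for the dual norm belonging to the inverse
  of \<open>B\<close>.\<close>

lemma inverse_operator:
  assumes A: "linear_on X X A" and sa: "self_adjoint_on X ip A" and pos: "pos_def_on X ip A"
  shows "linear_on X X (inv_into X A)" "self_adjoint_on X ip (inv_into X A)"
    "pos_def_on X ip (inv_into X A)"
proof -
  let ?A' = "inv_into X A"
  have bij: "bij_betw A X X" by (rule bij_betw_if_pos_def[OF A pos])
  have mem: "?A' y \<in> X" and right: "A (?A' y) = y" if "y \<in> X" for y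
    using bij that by (auto simp: bij_betw_def inv_into_into f_inv_into_f)
  have eqI: "?A' y = x" if "x \<in> X" "A x = y" for x y
    using bij that by (auto simp: bij_betw_def inv_into_f_f)
  show "linear_on X X ?A'"
    unfolding linear_on_def
  proof (intro conjI ballI allI)
    show "?A' x \<in> X" if "x \<in> X" for x by (rule mem[OF that])
    show "?A' (x + y) = ?A' x + ?A' y" if "x \<in> X" "y \<in> X" for x y
      using that A mem right by (intro eqI) (auto simp: linear_on_def subspace_add[OF subspace])
    show "?A' (c *\<^sub>R x) = c *\<^sub>R ?A' x" if "x \<in> X" for c x
      using that A mem right by (intro eqI) (auto simp: linear_on_def subspace_scale[OF subspace])
  qed
  show "self_adjoint_on X ip ?A'"
    using sa mem right unfolding self_adjoint_on_def by metis
  show "pos_def_on X ip ?A'"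
    unfolding pos_def_on_def
  proof (intro ballI impI)
    fix x assume x: "x \<in> X" "x \<noteq> 0"
    then have "?A' x \<noteq> 0" using right linear_on_0[OF A subspace] by metis
    then show "ip (?A' x) x > 0"
      using pos_def_onD[OF pos mem[OF x(1)]] right[OF x(1)] commute by metis
  qed
qed

section \<open>The norm of a positive definite operator and the energy estimate\<close>

context
  fixes S
  assumes lin: "linear_on X X S" and sa: "self_adjoint_on X ip S" and pos: "pos_def_on X ip S"
begin

lemma op_norm_nonneg: "x \<in> X \<Longrightarrow> op_norm ip S x \<ge> 0"
  by (simp add: op_norm_def pos_def_on_nonneg[OF pos])

lemma op_norm_square: "x \<in> X \<Longrightarrow> (op_norm ip S x)\<^sup>2 = ip (S x) x"
  by (simp add: op_norm_def pos_def_on_nonneg[OF pos])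

lemma op_sym: "x \<in> X \<Longrightarrow> y \<in> X \<Longrightarrow> ip (S y) x = ip (S x) y"
  using sa commute unfolding self_adjoint_on_def by metis

lemma op_norm_Cauchy_Schwarz:
  assumes x: "x \<in> X" and y: "y \<in> X"
  shows "ip (S x) y \<le> op_norm ip S x * op_norm ip S y"
proof (cases "y = 0")
  case True
  then show ?thesis by (simp add: op_norm_def)
next
  case False
  let ?b = "ip (S x) y" and ?c = "ip (S y) y"
  have c: "?c > 0" by (rule pos_def_onD[OF pos y False])
  \<comment> \<open>The coefficient minimises the quadratic form of \<open>S\<close> along the line
    through \<open>x\<close> in direction \<open>y\<close>. That the minimum is nonnegative is the
    Cauchy-Schwarz inequality.\<close>
  let ?z = "x + (- ?b / ?c) *\<^sub>R y"
  have z: "?z \<in> X" using x y by (intro subspace_add[OF subspace] subspace_scale[OF subspace])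
  have S: "S ?z = S x + (- ?b / ?c) *\<^sub>R S y"
    using lin x y subspace_scale[OF subspace] unfolding linear_on_def by metis
  have "0 \<le> ip (S ?z) ?z" by (rule pos_def_on_nonneg[OF pos z])
  also have "\<dots> = ip (S x) x - ?b\<^sup>2 / ?c"
    using c unfolding S
    by (simp only: add_left add_right scale_left scale_right op_sym[OF x y])
       (simp add: field_simps power2_eq_square)
  finally have "?b\<^sup>2 \<le> ip (S x) x * ?c" using c by (simp add: field_simps)
  also have "\<dots> = (op_norm ip S x * op_norm ip S y)\<^sup>2"
    by (simp add: power_mult_distrib op_norm_square x y)
  finally show ?thesis
    by (rule power2_le_imp_le) (simp add: op_norm_nonneg x y)
qed

lemma op_norm_triangle:
  assumes x: "x \<in> X" and y: "y \<in> X"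
  shows "op_norm ip S (x + y) \<le> op_norm ip S x + op_norm ip S y"
proof (rule power2_le_imp_le)
  have "S (x + y) = S x + S y" using lin x y by (simp add: linear_on_def)
  then have "(op_norm ip S (x + y))\<^sup>2
      = (op_norm ip S x)\<^sup>2 + (op_norm ip S y)\<^sup>2 + 2 * ip (S x) y"
    using x y op_sym[OF x y]
    by (simp add: op_norm_square subspace_add[OF subspace] add_left add_right)
  then show "(op_norm ip S (x + y))\<^sup>2 \<le> (op_norm ip S x + op_norm ip S y)\<^sup>2"
    using op_norm_Cauchy_Schwarz[OF x y] by (simp add: power2_sum)
  show "0 \<le> op_norm ip S x + op_norm ip S y" by (simp add: op_norm_nonneg x y)
qed

lemma is_norm_on_op_norm: "is_norm_on X (op_norm ip S)"
  unfolding is_norm_on_def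
proof (intro conjI ballI allI)
  show "op_norm ip S x = 0 \<longleftrightarrow> x = 0" if "x \<in> X" for x
    using pos_def_onD[OF pos that] by (cases "x = 0") (auto simp: op_norm_def)
  show "op_norm ip S (c *\<^sub>R x) = \<bar>c\<bar> * op_norm ip S x" if "x \<in> X" for c x
  proof -
    have "ip (S (c *\<^sub>R x)) (c *\<^sub>R x) = c\<^sup>2 * ip (S x) x"
      using lin that by (simp add: linear_on_def scale_left scale_right power2_eq_square)
    then show ?thesis by (simp add: op_norm_def real_sqrt_mult)
  qed
qed (auto simp: op_norm_nonneg op_norm_triangle)

text \<open>Writing \<open>f = S w\<close>, the \<open>S\<close>-norm of \<open>w\<close> equals the
  dual norm of \<open>f\<close>, and Cauchy-Schwarz for \<open>w\<close> and \<open>v\<close>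
  applies.\<close>

lemma pairing_le:
  assumes f: "f \<in> X" and v: "v \<in> X"
  shows "ip f v \<le> op_norm ip (inv_into X S) f * op_norm ip S v"
proof -
  let ?w = "inv_into X S f"
  have "bij_betw S X X" by (rule bij_betw_if_pos_def[OF lin pos])
  then have w: "?w \<in> X" "S ?w = f"
    using f by (auto simp: bij_betw_def inv_into_into f_inv_into_f)
  have "op_norm ip S ?w = op_norm ip (inv_into X S) f"
    using w commute by (simp add: op_norm_def)
  then show ?thesis using op_norm_Cauchy_Schwarz[OF w(1) v] w(2) by simp
qed

end

text \<open>Pairing the step with \<open>g' + g\<close> turns the first term into a difference of
  squared norms, because \<open>S\<close> is self-adjoint; the \<open>T\<close> term is dropped by
  sign. A common factor, the sum of the two norms, is then cancelled.\<close>

lemma two_layer_estimate: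
  assumes S: "linear_on X X S" "self_adjoint_on X ip S" "pos_def_on X ip S"
    and T: "ip (T (g' + g)) (g' + g) \<ge> 0"
    and X: "g \<in> X" "g' \<in> X" "f \<in> X" and \<tau>: "\<tau> > 0"
    and step: "(1 / \<tau>) *\<^sub>R S (g' - g) + (1 / 2) *\<^sub>R T (g' + g) = f"
  shows "op_norm ip S g' \<le> op_norm ip S g + \<tau> * op_norm ip (inv_into X S) f"
proof -
  let ?n = "op_norm ip S" and ?F = "op_norm ip (inv_into X S) f"
  have mem: "g' + g \<in> X" "g' - g \<in> X"
    using X subspace subspace_add subspace_diff by blast+
  have "S g' = S (g' - g) + S g"
    using S(1) X mem unfolding linear_on_def by (metis diff_add_cancel)
  then have "ip (S (g' - g)) (g' + g) = (?n g')\<^sup>2 - (?n g)\<^sup>2"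
    using op_sym[OF S X(1,2)] X
    by (simp add: add_left add_right op_norm_square[OF S] algebra_simps)
  moreover have "ip f (g' + g)
      = (1 / \<tau>) * ip (S (g' - g)) (g' + g) + (1 / 2) * ip (T (g' + g)) (g' + g)"
    by (simp only: step[symmetric] add_left scale_left)
  moreover have "ip f (g' + g) \<le> ?F * (?n g' + ?n g)"
  proof -
    have F: "?F \<ge> 0"
      by (rule op_norm_nonneg[OF inverse_operator[OF S] X(3)])
    show ?thesis
      using pairing_le[OF S X(3) mem(1)] mult_left_mono[OF op_norm_triangle[OF S X(2,1)] F] by linarith
  qed
  moreover have "(1 / 2) * ip (T (g' + g)) (g' + g) \<ge> 0" using T by simp
  ultimately have "(1 / \<tau>) * ((?n g')\<^sup>2 - (?n g)\<^sup>2) \<le> ?F * (?n g' + ?n g)"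
    by simp
  then have le: "(?n g' - ?n g) * (?n g' + ?n g) \<le> \<tau> * ?F * (?n g' + ?n g)"
    using \<tau> by (simp add: field_simps power2_eq_square)
  have nn: "?n g \<ge> 0" "?n g' \<ge> 0" "?F \<ge> 0"
    using op_norm_nonneg[OF S] op_norm_nonneg[OF inverse_operator[OF S]] X by auto
  show ?thesis
  \<comment> \<open>If the factor to be cancelled is zero, both norms vanish and the right-hand side
    is nonnegative anyway.\<close>
  proof (cases "?n g' + ?n g = 0")
    case True
    moreover have "\<tau> * ?F \<ge> 0" using nn \<tau> by simp
    ultimately show ?thesis using nn by linarith
  next
    case False
    then have "?n g' + ?n g > 0" using nn by linarith
    then show ?thesis using mult_right_le_imp_le[OF le] by simp
  qed
qed

end

section \<open>Existence of adjoints\<close>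

lemma adjoint_on_frame:
  assumes X: "finite_frame X ipX I e" and Y: "finite_frame Y ipY J f" and A: "linear_on X Y A"
  shows "y \<in> Y \<Longrightarrow> adjoint_on X ipX Y ipY A y \<in> X"
    and "x \<in> X \<Longrightarrow> y \<in> Y \<Longrightarrow> ipY (A x) y = ipX x (adjoint_on X ipX Y ipY A y)"
proof -
  interpret X: finite_frame X ipX I e by (rule X)
  interpret Y: finite_frame Y ipY J f by (rule Y)
  \<comment> \<open>The frame coefficients of the adjoint at \<open>y\<close> must be the products
    of \<open>y\<close> with \<open>A (e i)\<close>. This witness justifies the choice made in
    \<open>adjoint_on\<close>.\<close>
  let ?A' = "\<lambda>y. \<Sum>i\<in>I. ipY y (A (e i)) *\<^sub>R e i"
  let ?P = "\<lambda>A'. (\<forall>y\<in>Y. A' y \<in> X) \<and> (\<forall>x\<in>X. \<forall>y\<in>Y. ipY (A x) y = ipX x (A' y))"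
  have "?P ?A'"
  proof (intro conjI ballI)
    show "?A' y \<in> X" for y
      by (intro subspace_sum[OF X.subspace] subspace_scale[OF X.subspace] X.frame_mem)
    show "ipY (A x) y = ipX x (?A' y)" if x: "x \<in> X" for x y
    proof -
      have "A x = (\<Sum>i\<in>I. ipX x (e i) *\<^sub>R A (e i))"
        using linear_on_sum[where v = e and c = "\<lambda>i. ipX x (e i)", OF A X.subspace X.finite_index]
          X.frame_mem X.expansion[OF x] by simp
      then have "ipY (A x) y = (\<Sum>i\<in>I. ipX x (e i) * ipY y (A (e i)))"
        by (subst Y.commute) (simp add: Y.sum_right Y.scale_right)
      then show ?thesis by (simp add: X.sum_right X.scale_right mult.commute)
    qed
  qed
  then have "?P (adjoint_on X ipX Y ipY A)"
    unfolding adjoint_on_def by (rule someI[of ?P])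
  then show "y \<in> Y \<Longrightarrow> adjoint_on X ipX Y ipY A y \<in> X"
    and "x \<in> X \<Longrightarrow> y \<in> Y \<Longrightarrow> ipY (A x) y = ipX x (adjoint_on X ipX Y ipY A y)"
    by blast+
qed

section \<open>Frames for the spaces of grid functions and grid vector functions\<close>

text \<open>The factor makes the point mass a unit vector for the weight \<open>h1 * h2\<close>.\<close>

definition unit_mass :: "real \<Rightarrow> real \<Rightarrow> node \<Rightarrow> grid_fun" where
  "unit_mass h1 h2 x = (\<lambda>z. if z = x then 1 / sqrt (h1 * h2) else 0)"

lemma ip_on_unit_mass:
  assumes "finite S" "x \<in> S" "h1 * h2 > 0"
  shows "ip_on h1 h2 S y (unit_mass h1 h2 x) = y x * sqrt (h1 * h2)"
proof -
  have "ip_on h1 h2 S y (unit_mass h1 h2 x)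
      = (\<Sum>z\<in>S. if z = x then y x * ((h1 * h2) / sqrt (h1 * h2)) else 0)"
    unfolding ip_on_def unit_mass_def by (rule sum.cong) (auto simp: mult.assoc)
  also have "\<dots> = y x * sqrt (h1 * h2)"
    using assms by (simp add: real_div_sqrt)
  finally show ?thesis .
qed

lemma ip_on_commute: "ip_on h1 h2 S y w = ip_on h1 h2 S w y"
  by (simp add: ip_on_def mult.commute mult.left_commute)

lemma ip_on_add_left: "ip_on h1 h2 S (y + w) z = ip_on h1 h2 S y z + ip_on h1 h2 S w z"
  by (simp add: ip_on_def sum.distrib[symmetric] algebra_simps)

lemma ip_on_scale_left: "ip_on h1 h2 S (c *\<^sub>R y) z = c * ip_on h1 h2 S y z"
  by (simp add: ip_on_def scaleR_fun_def sum_distrib_left mult.assoc)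

lemma ip_on_0_right: "ip_on h1 h2 S y 0 = 0"
  by (simp add: ip_on_def)

lemma subspace_funs_on: "subspace (funs_on S)"
  by (rule subspaceI) (auto simp: funs_on_def scaleR_fun_def)

lemma unit_mass_mem: "x \<in> S \<Longrightarrow> unit_mass h1 h2 x \<in> funs_on S"
  by (auto simp: unit_mass_def funs_on_def)

lemma funs_on_expansion:
  assumes "finite S" "h1 * h2 > 0" "y \<in> funs_on S"
  shows "y z = (\<Sum>x\<in>S. y x * sqrt (h1 * h2) * unit_mass h1 h2 x z)"
proof -
  have "(\<Sum>x\<in>S. y x * sqrt (h1 * h2) * unit_mass h1 h2 x z) = (\<Sum>x\<in>S. if z = x then y x else 0)"
    using assms(2) by (intro sum.cong) (auto simp: unit_mass_def)
  also have "\<dots> = y z" using assms(1,3) by (cases z) (simp add: funs_on_def)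
  finally show ?thesis by simp
qed

lemma finite_frame_funs_on:
  assumes "finite S" "h1 * h2 > 0"
  shows "finite_frame (funs_on S) (ip_on h1 h2 S) S (unit_mass h1 h2)"
proof
  show "y = (\<Sum>x\<in>S. ip_on h1 h2 S y (unit_mass h1 h2 x) *\<^sub>R unit_mass h1 h2 x)"
    if "y \<in> funs_on S" for y
  proof
    fix z
    have "(\<Sum>x\<in>S. ip_on h1 h2 S y (unit_mass h1 h2 x) *\<^sub>R unit_mass h1 h2 x) z
        = (\<Sum>x\<in>S. y x * sqrt (h1 * h2) * unit_mass h1 h2 x z)"
      using assms by (simp add: sum_fun_apply scaleR_fun_def ip_on_unit_mass)
    also have "\<dots> = y z" by (rule funs_on_expansion[OF assms that, symmetric])
    finally show "y z = (\<Sum>x\<in>S. ip_on h1 h2 S y (unit_mass h1 h2 x) *\<^sub>R unit_mass h1 h2 x) z"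
      by (rule sym)
  qed
  show "ip_on h1 h2 S y w = ip_on h1 h2 S w y" for y w
    by (rule ip_on_commute)
qed (use assms in \<open>auto simp: subspace_funs_on ip_on_add_left ip_on_scale_left unit_mass_mem\<close>)

lemma UNIV_comp: "UNIV = {Plus1, Minus1, Plus2, Minus2}"
  using comp.exhaust by auto

lemma ip_V_UNIV: "ip_V N1 N2 h1 h2 q g = (\<Sum>k\<in>UNIV. ip_on h1 h2 (subgrid N1 N2 k) (q k) (g k))"
  by (simp only: ip_V_def UNIV_comp)

lemma finite_subgrid: "finite (subgrid N1 N2 k)"
  by (cases k) auto

lemma ip_V_single:
  "ip_V N1 N2 h1 h2 q (0(k := y)) = ip_on h1 h2 (subgrid N1 N2 k) (q k) y"
proof -
  have "ip_V N1 N2 h1 h2 q (0(k := y))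
      = (\<Sum>j\<in>UNIV. if j = k then ip_on h1 h2 (subgrid N1 N2 k) (q k) y else 0)"
    unfolding ip_V_UNIV by (rule sum.cong) (auto simp: ip_on_0_right)
  also have "finite (UNIV :: comp set)" by (simp add: UNIV_comp)
  then have "(\<Sum>j\<in>UNIV. if j = k then ip_on h1 h2 (subgrid N1 N2 k) (q k) y else 0)
      = ip_on h1 h2 (subgrid N1 N2 k) (q k) y" by simp
  finally show ?thesis .
qed

text \<open>The frame collects the point masses of the four components, each put into its own
  component with zeros elsewhere; an index is a component together with one of its nodes.\<close>

lemma finite_frame_V_space:
  assumes h: "h1 * h2 > 0"
  shows "finite_frame (V_space N1 N2) (ip_V N1 N2 h1 h2) (Sigma UNIV (subgrid N1 N2))
    (\<lambda>(k, x). 0(k := unit_mass h1 h2 x))"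
proof
  let ?e = "\<lambda>(k, x). (0::grid_vec)(k := unit_mass h1 h2 x)"
  let ?I = "Sigma UNIV (subgrid N1 N2)"
  have fin: "finite (UNIV :: comp set)" by (simp add: UNIV_comp)
  show "finite ?I" using fin finite_subgrid by blast
  show "subspace (V_space N1 N2)"
    \<comment> \<open>Fixing the type of the argument to \<open>comp\<close> unfolds scaling over
      components only, so that scaled grid functions keep the form expected by the
      \<open>funs_on\<close> facts.\<close>
    by (rule subspaceI) (auto simp: V_space_def scaleR_fun_def[where 'a = comp]
      intro: subspace_0[OF subspace_funs_on] subspace_add[OF subspace_funs_on]
        subspace_scale[OF subspace_funs_on])
  show "?e i \<in> V_space N1 N2" if "i \<in> ?I" for i
    using that
    by (auto simp: V_space_def unit_mass_mem subspace_0[OF subspace_funs_on])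
  show "q = (\<Sum>i\<in>?I. ip_V N1 N2 h1 h2 q (?e i) *\<^sub>R ?e i)" if q: "q \<in> V_space N1 N2" for q
  proof (intro ext)
    fix j z
    have "(\<Sum>i\<in>?I. ip_V N1 N2 h1 h2 q (?e i) *\<^sub>R ?e i) j z
        = (\<Sum>(k, x)\<in>?I. q k x * sqrt (h1 * h2) * ((0::grid_vec)(k := unit_mass h1 h2 x)) j z)"
      unfolding sum_fun_apply
      by (rule sum.cong)
        (auto simp: scaleR_fun_def ip_V_single ip_on_unit_mass[OF finite_subgrid _ h])
    also have "\<dots> = (\<Sum>k\<in>UNIV. \<Sum>x\<in>subgrid N1 N2 k.
        q k x * sqrt (h1 * h2) * ((0::grid_vec)(k := unit_mass h1 h2 x)) j z)"
      by (rule sum.Sigma[symmetric]) (auto simp: fin finite_subgrid)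
    \<comment> \<open>Frame vectors of component \<open>k\<close> vanish in every other component,
      so only \<open>k = j\<close> contributes, through the expansion of \<open>q j\<close>.\<close>
    also have "\<dots> = (\<Sum>k\<in>UNIV. if k = j then q j z else 0)"
    proof (rule sum.cong)
      show "(\<Sum>x\<in>subgrid N1 N2 k. q k x * sqrt (h1 * h2) *
          ((0::grid_vec)(k := unit_mass h1 h2 x)) j z) = (if k = j then q j z else 0)" for k
        using funs_on_expansion[OF finite_subgrid h, of "q j" N1 N2 j z, symmetric] q
        by (auto simp: V_space_def)
    qed simp
    also have "\<dots> = q j z" using fin by simp
    finally show "q j z = (\<Sum>i\<in>?I. ip_V N1 N2 h1 h2 q (?e i) *\<^sub>R ?e i) j z" by simp
  qed
  show "ip_V N1 N2 h1 h2 x y = ip_V N1 N2 h1 h2 y x" for x y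
    by (simp add: ip_V_UNIV ip_on_commute)
  show "ip_V N1 N2 h1 h2 (x + y) z = ip_V N1 N2 h1 h2 x z + ip_V N1 N2 h1 h2 y z" for x y z
    by (simp add: ip_V_UNIV ip_on_add_left sum.distrib)
  show "ip_V N1 N2 h1 h2 (c *\<^sub>R x) z = c * ip_V N1 N2 h1 h2 x z" for c x z
    by (simp add: ip_V_UNIV scaleR_fun_def[where 'a = comp] ip_on_scale_left sum_distrib_left)
qed

section \<open>Linearity of the grid gradient\<close>

lemma grid_grad_mem: "grid_grad N1 N2 h1 h2 y \<in> V_space N1 N2"
  by (simp add: grid_grad_def V_space_def funs_on_def)

lemma diff_quot_add: "diff_quot h1 h2 k (y + w) x = diff_quot h1 h2 k y x + diff_quot h1 h2 k w x"
  by (cases k) (simp_all add: add_divide_distrib diff_divide_distrib)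

lemma diff_quot_scale: "diff_quot h1 h2 k (\<lambda>z. c * y z) x = c * diff_quot h1 h2 k y x"
  by (cases k) (simp_all add: right_diff_distrib[symmetric])

lemma linear_on_grid_grad: "linear_on X (V_space N1 N2) (grid_grad N1 N2 h1 h2)"
  unfolding linear_on_def
proof (intro conjI ballI allI)
  show "grid_grad N1 N2 h1 h2 y \<in> V_space N1 N2" for y by (rule grid_grad_mem)
  show "grid_grad N1 N2 h1 h2 (y + w) = grid_grad N1 N2 h1 h2 y + grid_grad N1 N2 h1 h2 w" for y w
    by (intro ext) (simp add: grid_grad_def diff_quot_add)
  show "grid_grad N1 N2 h1 h2 (c *\<^sub>R y) = c *\<^sub>R grid_grad N1 N2 h1 h2 y" for c y
    by (intro ext) (simp add: grid_grad_def scaleR_fun_def diff_quot_scale)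
qed

section \<open>Stability of the scheme with factorized operator\<close>

theorem theorem4:
  fixes l1 l2 h1 h2 \<sigma> \<tau> :: real and N1 N2 :: nat
    and H :: "grid_fun set" and V :: "grid_vec set"
    and ipH :: "grid_fun \<Rightarrow> grid_fun \<Rightarrow> real" and ipV :: "grid_vec \<Rightarrow> grid_vec \<Rightarrow> real"
    and D :: "grid_fun \<Rightarrow> grid_vec" and D_adj :: "grid_vec \<Rightarrow> grid_fun"
    and K C R R1 R2 A B :: "grid_vec \<Rightarrow> grid_vec"
  assumes mesh: "l1 > 0" "l2 > 0" "N1 > 0" "N2 > 0" "h1 = l1 / real N1" "h2 = l2 / real N2"
    and H: "H = H_space N1 N2" "ipH = ip_H N1 N2 h1 h2"
    and V: "V = V_space N1 N2" "ipV = ip_V N1 N2 h1 h2"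
    and D: "D = grid_grad N1 N2 h1 h2"
    and D_adj: "D_adj = adjoint_on H ipH V ipV D"
    and K: "linear_on V V K" "self_adjoint_on V ipV K" "pos_def_on V ipV K"
    and C: "C = inv_into V K"
    and R: "R = D \<circ> D_adj"
    and R12: "linear_on V V R1" "linear_on V V R2"
    and decomposition: "\<forall>q\<in>V. R q = R1 q + R2 q"
    and R1_adj: "\<forall>q\<in>V. adjoint_on V ipV V ipV R1 q = R2 q"
    and triangular:
      "block_lower_triangular N1 N2 R1 \<and> block_upper_triangular N1 N2 R2 \<or>
       block_upper_triangular N1 N2 R1 \<and> block_lower_triangular N1 N2 R2"
    and \<tau>: "\<tau> > 0"
    and A: "A = (C + (\<sigma> * \<tau>) *\<^sub>R R1) \<circ> inv_into V C \<circ> (C + (\<sigma> * \<tau>) *\<^sub>R R2)"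
    and B: "B = A - (\<tau> / 2) *\<^sub>R R"
    and \<sigma>: "\<sigma> \<ge> 1 / 2"
  shows "linear_on V V B \<and> self_adjoint_on V ipV B \<and> pos_def_on V ipV B \<and>
    bij_betw B V V \<and>
    is_norm_on V (op_norm ipV B) \<and> is_norm_on V (op_norm ipV (inv_into V B)) \<and>
    (\<forall>(N::nat) (u0::grid_fun) (\<phi> :: nat \<Rightarrow> grid_fun) (g :: nat \<Rightarrow> grid_vec).
       N \<ge> 1 \<and> u0 \<in> H \<and> (\<forall>n<N. \<phi> n \<in> H) \<and> (\<forall>n\<le>N. g n \<in> V) \<and>
       g 0 = K (D u0) \<and>
       (\<forall>n<N. A ((1 / \<tau>) *\<^sub>R (g (n + 1) - g n)) + R (g n) = D (\<phi> n)) \<longrightarrow>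
       (\<forall>n<N. op_norm ipV B (g (n + 1))
               \<le> op_norm ipV B (g n) + \<tau> * op_norm ipV (inv_into V B) (D (\<phi> n))))"
proof -
  have h: "h1 * h2 > 0" using mesh by simp
  have fH: "finite_frame H ipH (interior_nodes N1 N2) (unit_mass h1 h2)"
    unfolding H H_space_def ip_H_def
    by (rule finite_frame_funs_on[OF _ h]) (simp add: interior_nodes_def)
  note fV = finite_frame_V_space[OF h, of N1 N2, folded V]
  interpret H: finite_frame H ipH "interior_nodes N1 N2" "unit_mass h1 h2" by (rule fH)
  interpret V: finite_frame V ipV "Sigma UNIV (subgrid N1 N2)"
    "\<lambda>(k, x). 0(k := unit_mass h1 h2 x)" by (rule fV)
  have Dlin: "linear_on H V D" unfolding D V by (rule linear_on_grid_grad)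
  have DV: "D y \<in> V" for y unfolding D V by (rule grid_grad_mem)
  note D_adj_props = adjoint_on_frame[OF fH fV Dlin, folded D_adj]
  \<comment> \<open>Moving \<open>D\<close> across the scalar product gives
    \<open>ipH (D_adj q) (D_adj q)\<close>.\<close>
  have R_nonneg: "ipV (R q) q \<ge> 0" if "q \<in> V" for q
    using D_adj_props that H.nonneg by (simp add: R)
  have R1_R2: "ipV (R1 p) q = ipV p (R2 q)" if "p \<in> V" "q \<in> V" for p q
    using adjoint_on_frame(2)[OF fV fV R12(1)] R1_adj that by simp
  \<comment> \<open>Taking adjoints swaps the two summands \<open>R1\<close> and \<open>R2\<close>,
    so their sum is symmetric.\<close>
  have R_sa: "ipV (R p) q = ipV p (R q)" if "p \<in> V" "q \<in> V" for p q
    using R1_R2[OF that] R1_R2[OF that(2,1)] decomposition that V.commute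
    by (simp add: V.add_left V.add_right)
  note C_props = V.inverse_operator[OF K, folded C]
  have K_bij: "bij_betw K V V" by (rule V.bij_betw_if_pos_def[OF K(1,3)])
  have CK: "C (K q) = q" and KC: "K (C q) = q" if "q \<in> V" for q
    using K_bij that by (auto simp: C bij_betw_def inv_into_f_f f_inv_into_f)
  \<comment> \<open>\<open>inv_into V C\<close> is determined only on the image of \<open>V\<close>
    under \<open>C\<close>, which is \<open>V\<close>; agreement with \<open>K\<close> is therefore
    claimed on \<open>V\<close> alone.\<close>
  have C_inv: "inv_into V C q = K q" if "q \<in> V" for q
    using V.bij_betw_if_pos_def[OF C_props(1,3)] CK[OF that] K(1) that
    by (auto simp: bij_betw_def linear_on_def intro: inv_into_f_eq)
  let ?s = "\<sigma> * \<tau>"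
  have mem: "C q \<in> V" "K q \<in> V" "R1 q \<in> V" "R2 q \<in> V" "R q \<in> V" if "q \<in> V" for q
    using that C_props(1) K(1) R12 DV by (auto simp: linear_on_def R)
  note add_mem = subspace_add[OF V.subspace] and scale_mem = subspace_scale[OF V.subspace]
  \<comment> \<open>The factors are applied from right to left. \<open>K\<close> and
    \<open>C\<close> cancel each other, and the two terms linear in \<open>?s\<close> merge into
    \<open>?s *\<^sub>R R q\<close>.\<close>
  have A_eq: "A q = C q + ?s *\<^sub>R R q + ?s\<^sup>2 *\<^sub>R R1 (K (R2 q))" if q: "q \<in> V" for q
  proof -
    have m: "C q + ?s *\<^sub>R R2 q \<in> V" "?s *\<^sub>R R2 q \<in> V" "?s *\<^sub>R K (R2 q) \<in> V"
      using q mem add_mem scale_mem by auto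
    have k: "K (C q + ?s *\<^sub>R R2 q) = q + ?s *\<^sub>R K (R2 q)"
      using K(1) mem q m KC by (simp add: linear_on_def)
    have "C (q + ?s *\<^sub>R K (R2 q)) = C q + ?s *\<^sub>R R2 q"
      using C_props(1) mem q m CK by (simp add: linear_on_def)
    moreover have "R1 (q + ?s *\<^sub>R K (R2 q)) = R1 q + ?s *\<^sub>R R1 (K (R2 q))"
      using R12(1) mem q m by (simp add: linear_on_def)
    ultimately show ?thesis
      using m q decomposition
      \<comment> \<open>Grid vectors are functions too: instantiating \<open>scaleR_fun_def\<close>
        at \<open>R1\<close> and \<open>R2\<close> unfolds the scaling of operators without
        unfolding that of their values.\<close>
      by (simp add: A C_inv k scaleR_fun_def[of _ R1] scaleR_fun_def[of _ R2]
        scaleR_add_right power2_eq_square)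
  qed
  have B_eq: "B q = C q + (?s - \<tau> / 2) *\<^sub>R R q + ?s\<^sup>2 *\<^sub>R R1 (K (R2 q))" if q: "q \<in> V" for q
    using A_eq[OF q] by (simp add: B scaleR_fun_def[of _ R] scaleR_diff_left)
  have R_lin: "linear_on V V R"
    using R12 mem decomposition add_mem scale_mem
    by (simp add: linear_on_def scaleR_add_right)
  have B_lin: "linear_on V V B"
    unfolding linear_on_def
  proof (intro conjI ballI allI)
    show "B q \<in> V" if "q \<in> V" for q
      using that mem by (simp add: B_eq add_mem scale_mem)
    show "B (p + q) = B p + B q" if "p \<in> V" "q \<in> V" for p q
      using that mem C_props(1) R_lin R12 K(1)
      by (simp add: B_eq add_mem linear_on_def scaleR_add_right)
    show "B (c *\<^sub>R q) = c *\<^sub>R B q" if "q \<in> V" for c q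
      using that mem C_props(1) R_lin R12 K(1)
      by (simp add: B_eq scale_mem linear_on_def scaleR_add_right mult.commute)
  qed
  have R1KR2: "ipV (R1 (K (R2 p))) q = ipV (K (R2 p)) (R2 q)" if "p \<in> V" "q \<in> V" for p q
    using R1_R2 mem that by simp
  \<comment> \<open>In this shape every summand is symmetric in \<open>p\<close> and
    \<open>q\<close>, and for \<open>p = q\<close> none is negative once the middle coefficient is
    known to be nonnegative. Self-adjointness and positivity of \<open>B\<close> are read off from
    it.\<close>
  have B_form: "ipV (B p) q = ipV (C p) q + (?s - \<tau> / 2) * ipV (R p) q
      + ?s\<^sup>2 * ipV (K (R2 p)) (R2 q)" if "p \<in> V" "q \<in> V" for p q
    using that by (simp add: B_eq R1KR2 V.add_left V.scale_left)
  have B_sa: "self_adjoint_on V ipV B"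
    unfolding self_adjoint_on_def
  proof (intro ballI)
    fix p q assume pq: "p \<in> V" "q \<in> V"
    have "ipV p (B q) = ipV (B q) p" by (rule V.commute)
    moreover have "ipV (C q) p = ipV (C p) q" by (rule V.op_sym[OF C_props pq])
    moreover have "ipV (R q) p = ipV (R p) q" using R_sa[OF pq] V.commute by metis
    moreover have "ipV (K (R2 q)) (R2 p) = ipV (K (R2 p)) (R2 q)"
      by (rule V.op_sym[OF K mem(4)[OF pq(1)] mem(4)[OF pq(2)]])
    ultimately show "ipV (B p) q = ipV p (B q)" using B_form pq by simp
  qed
  \<comment> \<open>The condition on the weight enters here: the coefficient of \<open>R\<close> in
    \<open>B\<close> is \<open>(\<sigma> - 1/2) * \<tau>\<close>.\<close>
  have s: "?s - \<tau> / 2 \<ge> 0" using mult_right_mono[OF \<sigma>, of \<tau>] \<tau> by simp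
  have B_pos: "pos_def_on V ipV B"
    unfolding pos_def_on_def
  proof (intro ballI impI)
    fix q assume q: "q \<in> V" "q \<noteq> 0"
    have "ipV (C q) q > 0" by (rule V.pos_def_onD[OF C_props(3) q])
    moreover have "(?s - \<tau> / 2) * ipV (R q) q \<ge> 0" using s R_nonneg q by simp
    moreover have "?s\<^sup>2 * ipV (K (R2 q)) (R2 q) \<ge> 0"
      using V.pos_def_on_nonneg[OF K(3)] mem q by simp
    ultimately show "ipV (B q) q > 0" using B_form[OF q(1) q(1)] by linarith
  qed
  note B_props = B_lin B_sa B_pos
  have step: "op_norm ipV B g' \<le> op_norm ipV B g + \<tau> * op_norm ipV (inv_into V B) (D y)"
    if g: "g \<in> V" "g' \<in> V" and eq: "A ((1 / \<tau>) *\<^sub>R (g' - g)) + R g = D y" for g g' y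
  proof (rule V.two_layer_estimate[OF B_props])
    have d: "g' - g \<in> V" "g' + g \<in> V" using g V.subspace subspace_diff add_mem by blast+
    show "ipV (R (g' + g)) (g' + g) \<ge> 0" by (rule R_nonneg[OF d(2)])
    have "R g' = R (g' - g) + R g"
      using R_lin g d unfolding linear_on_def by (metis diff_add_cancel)
    \<comment> \<open>This serves to replace \<open>R g\<close> by half of \<open>R (g' + g)\<close>
      minus half of \<open>R (g' - g)\<close>.\<close>
    then have Rsum: "R (g' + g) = R (g' - g) + 2 *\<^sub>R R g"
      using R_lin g by (simp add: linear_on_def scaleR_2)
    let ?d = "(1 / \<tau>) *\<^sub>R (g' - g)"
    \<comment> \<open>The part of \<open>A\<close> beyond \<open>B\<close> contributes half of
      \<open>R (g' - g)\<close>, since \<open>\<tau>\<close> cancels. Together with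
      \<open>R g\<close> it makes half of \<open>R (g' + g)\<close>, the form required by the
      two-layer estimate.\<close>
    have "A ?d = B ?d + (\<tau> / 2) *\<^sub>R R ?d" by (simp add: B scaleR_fun_def[of _ R])
    also have "\<dots> = (1 / \<tau>) *\<^sub>R B (g' - g) + (1 / 2) *\<^sub>R R (g' - g)"
      using B_lin R_lin d \<tau> by (simp add: linear_on_def)
    finally show "(1 / \<tau>) *\<^sub>R B (g' - g) + (1 / 2) *\<^sub>R R (g' + g) = D y"
      using eq Rsum by (simp add: scaleR_add_right add.assoc)
  qed (use g DV \<tau> in auto)
  show ?thesis
    using B_props V.bij_betw_if_pos_def[OF B_lin B_pos] V.is_norm_on_op_norm[OF B_props]
      V.is_norm_on_op_norm[OF V.inverse_operator[OF B_props]] step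
    by auto
qed

end
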